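(* Let $\mathcal M$ and $\mathcal N=\{N^{(\lambda)}:\lambda\in\mathbb R_{>0}\}$ be two quasianalytic weight matrices such that $\sup_{k\in\mathbb N_{>0}}(n^{(\lambda)}_k)^{1/k}=+\infty$ for all $\lambda>0$ (Roumieu case) resp. $\lim_{k\to+\infty}(n^{(\lambda)}_k)^{1/k}=+\infty$ for all $\lambda>0$ (Beurling case). Then $j^\infty(\mathcal E^{0,r}_{\{\mathcal M\}})\cap\Lambda^r_{[\mathcal N]}\subsetneq\Lambda^r_{[\mathcal N]}$ (and hence also $j^\infty(\mathcal E^{0,r}_{(\mathcal M)})\cap\Lambda^r_{[\mathcal N]}\subsetneq\Lambda^r_{[\mathcal N]}$). In particular the Borel map $j^\infty:\mathcal E^{0,r}_{[\mathcal N]}\to\Lambda^r_{[\mathcal N]}$ is not surjective.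
   Context: For a sequence $M=(M_p)_{p\in\mathbb N}$ of positive reals write $m_p:=M_p/p!$. $M$ is a weight sequence if $1=M_0\le M_1$, $M_p^2\le M_{p-1}M_{p+1}$ for all $p\ge1$, and $\liminf_{p\to\infty}m_p^{1/p}>0$; it is quasianalytic if $\sum_{p\ge1}M_{p-1}/M_p=+\infty$. A weight matrix is a family $\mathcal M=\{M^{(\lambda)}:\lambda\in\mathbb R_{>0}\}$ of weight sequences with $M^{(\lambda)}_p\le M^{(\kappa)}_p$ for all $p$ whenever $\lambda\le\kappa$; write $n^{(\lambda)}_p:=N^{(\lambda)}_p/p!$. It is quasianalytic if every member is quasianalytic. For $U\subseteq\mathbb R^r$ open, $K\subseteq U$ compact, $h>0$: $\|f\|^M_{K,h}:=\sup_{\alpha\in\mathbb N^r,x\in K}|\partial^\alpha f(x)|/(h^{|\alpha|}M_{|\alpha|})$. $\mathcal E_{\{\mathcal M\}}(U)$: smooth $f$ such that for every compact $K\subseteq U$ there exist $\lambda>0$, $h>0$ with $\|f\|^{M^{(\lambda)}}_{K,h}<\infty$; $\mathcal E_{(\mathcal M)}(U)$: smooth $f$ with $\|f\|^{M^{(\lambda)}}_{K,h}<\infty$ for all compact $K$, all $\lambda>0$, all $h>0$. $\mathcal E^{0,r}_{\{\mathcal M\}}$, $\mathcal E^{0,r}_{(\mathcal M)}$ are the corresponding spaces of germs at $0\in\mathbb R^r$ (functions in the class on some cube $(-1/k,1/k)^r$). For $\mathbf b=(b_\alpha)_{\alpha\in\mathbb N^r}$, a weight sequence $N$, $h>0$: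 $|\mathbf b|^N_h:=\sup_\alpha|b_\alpha|/(h^{|\alpha|}n_{|\alpha|})$; $\Lambda^r_{\{\mathcal N\}}:=\{\mathbf b:\exists\lambda>0\,\exists h>0,\ |\mathbf b|^{N^{(\lambda)}}_h<\infty\}$, $\Lambda^r_{(\mathcal N)}:=\{\mathbf b:\forall\lambda>0\,\forall h>0,\ |\mathbf b|^{N^{(\lambda)}}_h<\infty\}$. The Borel map is $j^\infty(f)=(\partial^\alpha f(0)/|\alpha|!)_{\alpha\in\mathbb N^r}$. $[\cdot]$ means $\{\cdot\}$ throughout or $(\cdot)$ throughout. *)

theory Defs
  imports "HOL-Analysis.Analysis"
begin

definition weight_seq :: "(nat \<Rightarrow> real) \<Rightarrow> bool" where
  "weight_seq M \<longleftrightarrow> (\<forall>p. M p > 0) \<and> M 0 = 1 \<and> M 0 \<le> M 1 \<and>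
     (\<forall>p\<ge>1. (M p)\<^sup>2 \<le> M (p - 1) * M (p + 1)) \<and>
     Liminf sequentially (\<lambda>p. ereal (root p (M p / fact p))) > 0"

(* sum_{p>=1} M_{p-1}/M_p = +infinity; the terms are positive *)
definition quasianalytic_seq :: "(nat \<Rightarrow> real) \<Rightarrow> bool" where
  "quasianalytic_seq M \<longleftrightarrow> \<not> summable (\<lambda>p. M p / M (Suc p))"

(* a weight matrix is indexed by lambda in R_{>0}; values at lambda <= 0 are irrelevant *)
definition weight_matrix :: "(real \<Rightarrow> nat \<Rightarrow> real) \<Rightarrow> bool" where
  "weight_matrix \<M> \<longleftrightarrow> (\<forall>l>0. weight_seq (\<M> l)) \<and>
     (\<forall>l kap. 0 < l \<longrightarrow> l \<le> kap \<longrightarrow> (\<forall>p. \<M> l p \<le> \<M> kap p))"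

definition quasianalytic_matrix :: "(real \<Rightarrow> nat \<Rightarrow> real) \<Rightarrow> bool" where
  "quasianalytic_matrix \<M> \<longleftrightarrow> (\<forall>l>0. quasianalytic_seq (\<M> l))"

definition partial :: "'n::finite \<Rightarrow> (real^'n \<Rightarrow> real) \<Rightarrow> real^'n \<Rightarrow> real" where
  "partial i g x = deriv (\<lambda>t. g (x + t *\<^sub>R axis i 1)) 0"

fun iter_partial :: "'n::finite list \<Rightarrow> (real^'n \<Rightarrow> real) \<Rightarrow> real^'n \<Rightarrow> real" where
  "iter_partial [] f = f"
| "iter_partial (i # is) f = partial i (iter_partial is f)"

definition smooth_on :: "(real^'n::finite) set \<Rightarrow> (real^'n \<Rightarrow> real) \<Rightarrow> bool" where
  "smooth_on U f \<longleftrightarrow> (\<forall>is. continuous_on U (iter_partial is f) \<and>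
     (\<forall>i. \<forall>x\<in>U. (\<lambda>t. iter_partial is f (x + t *\<^sub>R axis i 1)) differentiable (at 0)))"

definition mlen :: "('n::finite \<Rightarrow> nat) \<Rightarrow> nat" where
  "mlen \<alpha> = (\<Sum>i\<in>UNIV. \<alpha> i)"

(* \<partial>^\<alpha> f: differentiate alpha i times in direction i (order irrelevant for smooth f) *)
definition pderiv_multi :: "('n::finite \<Rightarrow> nat) \<Rightarrow> (real^'n \<Rightarrow> real) \<Rightarrow> real^'n \<Rightarrow> real" where
  "pderiv_multi \<alpha> f = iter_partial (SOME is. \<forall>i. count_list is i = \<alpha> i) f"

definition seminorm_finite :: "(nat \<Rightarrow> real) \<Rightarrow> (real^'n::finite) set \<Rightarrow> real \<Rightarrow> (real^'n \<Rightarrow> real) \<Rightarrow> bool" where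
  "seminorm_finite M K h f \<longleftrightarrow>
     (\<exists>C. \<forall>\<alpha>. \<forall>x\<in>K. \<bar>pderiv_multi \<alpha> f x\<bar> / (h ^ mlen \<alpha> * M (mlen \<alpha>)) \<le> C)"

definition E_Roumieu :: "(real \<Rightarrow> nat \<Rightarrow> real) \<Rightarrow> (real^'n::finite) set \<Rightarrow> (real^'n \<Rightarrow> real) set" where
  "E_Roumieu \<M> U = {f. smooth_on U f \<and> (\<forall>K. compact K \<and> K \<subseteq> U \<longrightarrow>
      (\<exists>l>0. \<exists>h>0. seminorm_finite (\<M> l) K h f))}"

definition E_Beurling :: "(real \<Rightarrow> nat \<Rightarrow> real) \<Rightarrow> (real^'n::finite) set \<Rightarrow> (real^'n \<Rightarrow> real) set" where
  "E_Beurling \<M> U = {f. smooth_on U f \<and> (\<forall>K. compact K \<and> K \<subseteq> U \<longrightarrow>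
      (\<forall>l>0. \<forall>h>0. seminorm_finite (\<M> l) K h f))}"

definition cube :: "nat \<Rightarrow> (real^'n::finite) set" where
  "cube k = {x. \<forall>i. \<bar>x $ i\<bar> < 1 / real k}"

definition jet :: "(real^'n::finite \<Rightarrow> real) \<Rightarrow> ('n \<Rightarrow> nat) \<Rightarrow> real" where
  "jet f = (\<lambda>\<alpha>. pderiv_multi \<alpha> f 0 / fact (mlen \<alpha>))"

(* j^\<infinity>(E^{0,r}_{[M]}): images of germs at 0, i.e. of functions in the class on some cube *)
definition jets_Roumieu :: "(real \<Rightarrow> nat \<Rightarrow> real) \<Rightarrow> (('n::finite \<Rightarrow> nat) \<Rightarrow> real) set" where
  "jets_Roumieu \<M> = {jet f | f k. k \<ge> 1 \<and> f \<in> E_Roumieu \<M> (cube k)}"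

definition jets_Beurling :: "(real \<Rightarrow> nat \<Rightarrow> real) \<Rightarrow> (('n::finite \<Rightarrow> nat) \<Rightarrow> real) set" where
  "jets_Beurling \<M> = {jet f | f k. k \<ge> 1 \<and> f \<in> E_Beurling \<M> (cube k)}"

definition seqnorm_finite :: "(nat \<Rightarrow> real) \<Rightarrow> real \<Rightarrow> (('n::finite \<Rightarrow> nat) \<Rightarrow> real) \<Rightarrow> bool" where
  "seqnorm_finite N h b \<longleftrightarrow>
     (\<exists>C. \<forall>\<alpha>. \<bar>b \<alpha>\<bar> / (h ^ mlen \<alpha> * (N (mlen \<alpha>) / fact (mlen \<alpha>))) \<le> C)"

definition Lambda_Roumieu :: "(real \<Rightarrow> nat \<Rightarrow> real) \<Rightarrow> (('n::finite \<Rightarrow> nat) \<Rightarrow> real) set" where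
  "Lambda_Roumieu \<N> = {b. \<exists>l>0. \<exists>h>0. seqnorm_finite (\<N> l) h b}"

definition Lambda_Beurling :: "(real \<Rightarrow> nat \<Rightarrow> real) \<Rightarrow> (('n::finite \<Rightarrow> nat) \<Rightarrow> real) set" where
  "Lambda_Beurling \<N> = {b. \<forall>l>0. \<forall>h>0. seqnorm_finite (\<N> l) h b}"

end

theory Submission
  imports Defs
begin

text \<open>
  If all derivatives of a quasianalytic function at a point are positive, they stay positive to
  the right of that point. Otherwise one of them has a zero, and Rolle's argument together with the
  positivity at the initial point yields a decreasing sequence of points at which the successive
  derivatives vanish; a theorem of Bang then makes the function vanish identically. Taylor's
  formula now bounds the Taylor coefficients by a geometric sequence. So any jet in the given
  sequence space that is positive along a coordinate axis and grows faster than geometrically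
  there is not the jet of a quasianalytic germ, whatever the quasianalytic matrix.
\<close>

section \<open>Logarithmically convex sequences\<close>

definition log_convex_seq :: "(nat \<Rightarrow> real) \<Rightarrow> bool" where
  "log_convex_seq M \<longleftrightarrow> (\<forall>p. 0 < M p \<and> (M (Suc p))\<^sup>2 \<le> M p * M (Suc (Suc p)))"

lemma log_convex_seq_pos: "log_convex_seq M \<Longrightarrow> 0 < M p"
  by (simp add: log_convex_seq_def)

lemma log_convex_seq_ratio_mono:
  assumes "log_convex_seq M" "j \<le> k"
  shows "M (Suc j) / M j \<le> M (Suc k) / M k"
proof -
  have "M (Suc p) / M p \<le> M (Suc (Suc p)) / M (Suc p)" for p
    using assms(1) log_convex_seq_pos[OF assms(1)]
    by (simp add: log_convex_seq_def field_simps power2_eq_square)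
  then have "incseq (\<lambda>p. M (Suc p) / M p)"
    by (rule incseq_SucI)
  then show ?thesis
    using \<open>j \<le> k\<close> by (rule incseqD)
qed

lemma log_convex_seq_geometric_mult:
  assumes "log_convex_seq M" "0 < c" "0 < h"
  shows "log_convex_seq (\<lambda>p. c * h ^ p * M p)"
  unfolding log_convex_seq_def
proof (intro allI conjI)
  fix p
  show "0 < c * h ^ p * M p"
    using assms log_convex_seq_pos by simp
  have "(c * h ^ Suc p)\<^sup>2 * (M (Suc p))\<^sup>2 \<le> (c * h ^ Suc p)\<^sup>2 * (M p * M (Suc (Suc p)))"
    using assms(1) by (intro mult_left_mono) (auto simp: log_convex_seq_def)
  then show "(c * h ^ Suc p * M (Suc p))\<^sup>2
      \<le> c * h ^ p * M p * (c * h ^ Suc (Suc p) * M (Suc (Suc p)))"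
    by (simp add: power2_eq_square mult_ac)
qed

lemma log_convex_seq_shift: "log_convex_seq M \<Longrightarrow> log_convex_seq (\<lambda>p. M (p + m))"
  by (simp add: log_convex_seq_def)

lemma weight_seq_imp_log_convex_seq: "weight_seq M \<Longrightarrow> log_convex_seq M"
  unfolding weight_seq_def log_convex_seq_def by (metis Suc_eq_plus1 diff_Suc_1 le_add2)

lemma quasianalytic_seq_geometric_mult:
  assumes "quasianalytic_seq M" "c \<noteq> 0" "h \<noteq> 0"
  shows "quasianalytic_seq (\<lambda>p. c * h ^ p * M p)"
proof -
  have "c * h ^ p * M p / (c * h ^ Suc p * M (Suc p)) = 1 / h * (M p / M (Suc p))" for p
    using assms by simp
  then show ?thesis
    using assms by (simp only: quasianalytic_seq_def summable_cmult_iff) simp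
qed

lemma quasianalytic_seq_shift: "quasianalytic_seq M \<Longrightarrow> quasianalytic_seq (\<lambda>p. M (p + m))"
  using summable_iff_shift[of "\<lambda>p. M p / M (Suc p)" m] by (simp add: quasianalytic_seq_def)

section \<open>Sequences of successive derivatives\<close>

locale derivative_tower =
  fixes g :: "nat \<Rightarrow> real \<Rightarrow> 'a::real_normed_vector" and a b :: real
  assumes deriv:
    "t \<in> {a..b} \<Longrightarrow> (g n has_vector_derivative g (Suc n) t) (at t within {a..b})"
begin

lemma continuous: "continuous_on {a..b} (g n)"
  using deriv by (rule continuous_on_vector_derivative)

lemma deriv_at: "a < t \<Longrightarrow> t < b \<Longrightarrow> (g n has_vector_derivative g (Suc n) t) (at t)"
  using deriv[of t n] by (simp add: at_within_Icc_at)

lemma shift: "derivative_tower (\<lambda>n. g (n + m)) a b"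
  using deriv by unfold_locales simp

lemma reflect: "derivative_tower (\<lambda>n t. (-1) ^ n *\<^sub>R g n (- t)) (- b) (- a)"
proof
  fix t n assume "t \<in> {- b..- a}"
  then have "(g n has_vector_derivative g (Suc n) (- t)) (at (- t) within uminus ` {- b..- a})"
    using deriv[of "- t" n] by simp
  from vector_diff_chain_within[OF has_vector_derivative_minus[OF has_vector_derivative_id] this]
  have "((\<lambda>t. g n (- t)) has_vector_derivative - g (Suc n) (- t)) (at t within {- b..- a})"
    by (simp add: o_def)
  from bounded_linear.has_vector_derivative[OF bounded_linear_scaleR_right this, of "(-1) ^ n"]
  show "((\<lambda>t. (-1) ^ n *\<^sub>R g n (- t)) has_vector_derivative (-1) ^ Suc n *\<^sub>R g (Suc n) (- t))
      (at t within {- b..- a})"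
    by simp
qed

end

lemma derivative_tower_exists_descending_zeros:
  fixes g :: "nat \<Rightarrow> real \<Rightarrow> real"
  assumes "derivative_tower g a b" and initial: "\<And>n. 0 < g n a"
    and t: "t \<in> {a..b}" "g 0 t \<le> 0"
  obtains x where "decseq x" "\<And>n. x n \<in> {a..b}" "\<And>n. g n (x n) = 0"
proof -
  interpret derivative_tower g a b by fact
  have zero: "\<exists>z. (z \<in> {a..b} \<and> g n z = 0) \<and> z \<le> s" if "s \<in> {a..b}" "g n s \<le> 0" for n s
    using that IVT2'[of "g n" s 0 a] initial[of n]
      continuous_on_subset[OF continuous, of "{a..s}" n]
    by fastforce
  have "\<exists>x. \<forall>n. (x n \<in> {a..b} \<and> g n (x n) = 0) \<and> x (Suc n) \<le> x n"
  proof (rule dependent_nat_choice)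
    show "\<exists>z. z \<in> {a..b} \<and> g 0 z = 0"
      using zero[OF t] by blast
  next
    fix s n assume s: "s \<in> {a..b} \<and> g n s = 0"
    then have "a < s"
      using initial[of n] by (auto simp: less_le)
    then obtain z where z: "a < z" "z < s" and "g n s - g n a = (s - a) * g (Suc n) z"
      using mvt[of a s "g n" "\<lambda>t h. h * g (Suc n) t"] s deriv_at
        continuous_on_subset[OF continuous, of "{a..s}" n]
      by (auto simp: has_vector_derivative_def)
    then have "(s - a) * g (Suc n) z < 0"
      using s initial[of n] by simp
    then have "g (Suc n) z \<le> 0"
      using \<open>a < s\<close> by (simp add: mult_less_0_iff)
    then show "\<exists>y. (y \<in> {a..b} \<and> g (Suc n) y = 0) \<and> y \<le> s"
      using zero[of z "Suc n"] z s by force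
  qed
  then show ?thesis
    using that by (auto simp: decseq_Suc_iff)
qed

lemma power_le_diff_of_power_le_derivative:
  fixes f :: "real \<Rightarrow> real"
  assumes "a \<le> s" "continuous_on {a..s} f"
    and deriv: "\<And>t. a < t \<Longrightarrow> t < s \<Longrightarrow> (f has_real_derivative f' t) (at t)"
    and le: "\<And>t. a < t \<Longrightarrow> t < s \<Longrightarrow> c * (real (Suc n) * (t - a) ^ n) \<le> f' t"
  shows "c * (s - a) ^ Suc n \<le> f s - f a"
proof -
  define r where "r t = f t - c * (t - a) ^ Suc n" for t
  have "r a \<le> r s"
  proof (rule DERIV_nonneg_imp_increasing_open[where f = r])
    fix t assume t: "a < t" "t < s"
    have "(r has_real_derivative f' t - c * (real (Suc n) * (t - a) ^ n)) (at t)"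
      unfolding r_def using deriv[OF t]
      by (auto intro!: derivative_eq_intros simp del: power_Suc)
    then show "\<exists>y. (r has_real_derivative y) (at t) \<and> 0 \<le> y"
      using le[OF t] by (intro exI conjI) auto
  qed (use assms in \<open>auto simp: r_def intro!: continuous_intros\<close>)
  then show ?thesis
    by (simp add: r_def)
qed

lemma derivative_tower_nonneg_Taylor_coeff_le:
  fixes g :: "nat \<Rightarrow> real \<Rightarrow> real"
  assumes "derivative_tower g a b" and nonneg: "\<And>n t. t \<in> {a..b} \<Longrightarrow> 0 \<le> g n t"
    and "s \<in> {a..b}"
  shows "g (m + n) a / fact n * (s - a) ^ n \<le> g m s"
proof -
  interpret derivative_tower g a b by fact
  have diff_ge: "c * (s - a) ^ Suc n \<le> g m s - g m a"
    if "s \<in> {a..b}" "\<And>t. a < t \<Longrightarrow> t < s \<Longrightarrow> c * (real (Suc n) * (t - a) ^ n) \<le> g (Suc m) t"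
    for c m n s
    using that deriv_at continuous_on_subset[OF continuous, of "{a..s}" m]
    by (intro power_le_diff_of_power_le_derivative[where f' = "g (Suc m)"])
      (auto simp: has_real_derivative_iff_has_vector_derivative)
  show ?thesis
    using \<open>s \<in> {a..b}\<close>
  proof (induction n arbitrary: m s)
    case 0
    then show ?case
      using diff_ge[of s 0 0 m] nonneg by auto
  next
    case (Suc n)
    define c where "c = g (m + Suc n) a / fact (Suc n)"
    have "c * (s - a) ^ Suc n \<le> g m s - g m a"
    proof (rule diff_ge[OF Suc.prems])
      fix t assume "a < t" "t < s"
      then have "g (Suc m + n) a / fact n * (t - a) ^ n \<le> g (Suc m) t"
        using Suc.prems by (intro Suc.IH) auto
      then show "c * (real (Suc n) * (t - a) ^ n) \<le> g (Suc m) t"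
        by (simp add: c_def)
    qed
    also have "\<dots> \<le> g m s"
      using nonneg[of a m] Suc.prems by auto
    finally show ?case
      by (simp only: c_def)
  qed
qed

section \<open>Bang's theorem\<close>

lemma norm_le_exp_of_derivative_le:
  fixes f :: "real \<Rightarrow> 'a::real_normed_vector"
  assumes "p \<le> q" and "continuous_on {p..q} f"
    and "\<And>t. p < t \<Longrightarrow> t < q \<Longrightarrow> (f has_vector_derivative f' t) (at t)"
    and "\<And>t. p < t \<Longrightarrow> t < q \<Longrightarrow> norm (f' t) \<le> A * exp (c * (t - r)) * c"
    and initial: "norm (f p) \<le> A * exp (c * (p - r))"
  shows "norm (f q) \<le> A * exp (c * (q - r))"
proof (cases "p = q")
  case False
  have "norm (f q - f p) \<le> A * exp (c * (q - r)) - A * exp (c * (p - r))"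
  proof (rule differentiable_bound_general)
    show "((\<lambda>t. A * exp (c * (t - r))) has_vector_derivative A * exp (c * (t - r)) * c) (at t)"
      for t
      unfolding has_real_derivative_iff_has_vector_derivative[symmetric]
      by (auto intro!: derivative_eq_intros)
  qed (use False assms in \<open>auto intro!: continuous_intros\<close>)
  then show ?thesis
    using initial norm_triangle_sub[of "f q" "f p"] by linarith
qed (use initial in simp)

lemma log_convex_seq_exp_Suc_le:
  assumes "log_convex_seq M" "j \<le> k"
  shows "M (Suc j) * exp (real (Suc j) - s) \<le> M j * exp (real j - s) * (exp 1 * (M (Suc k) / M k))"
proof -
  have "M (Suc j) \<le> M j * (M (Suc k) / M k)"
    using log_convex_seq_ratio_mono[OF assms] log_convex_seq_pos[OF assms(1), of j]
    by (simp add: field_simps)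
  then have "M (Suc j) * (exp (real j - s) * exp 1)
      \<le> M j * (M (Suc k) / M k) * (exp (real j - s) * exp 1)"
    by (intro mult_right_mono) auto
  moreover have "exp (real (Suc j) - s) = exp (real j - s) * exp 1"
    by (simp add: exp_add[symmetric])
  ultimately show ?thesis
    by (simp only: mult_ac)
qed

locale bounded_derivative_tower = derivative_tower +
  fixes M :: "nat \<Rightarrow> real"
  assumes norm_le: "t \<in> {a..b} \<Longrightarrow> norm (g n t) \<le> M n"
    and log_convex: "log_convex_seq M"
begin

lemmas M_pos = log_convex_seq_pos[OF log_convex]

text \<open>
  The j-th derivative is controlled only to the right of the j-th zero. As the zeros decrease, this
  region is contained in the one for the next derivative. Passing from \<open>Suc k\<close> to \<open>k\<close> in the bound
  \<open>M j * exp (j - n)\<close> pays for a further step of length \<open>M k / M (Suc k) / exp 1\<close> to the right;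
  as these lengths are not summable, finitely many steps cover the interval.
\<close>

context
  fixes x :: "nat \<Rightarrow> real"
  assumes decseq_zeros: "decseq x" and zeros_in: "\<And>n. x n \<in> {a..b}" and zeros: "\<And>n. g n (x n) = 0"
begin

lemma Bang_exponential_bound:
  assumes initial: "\<And>j. j \<le> k \<Longrightarrow> x j \<le> r \<Longrightarrow> norm (g j r) \<le> M j * exp (real j - real (Suc k))"
    and "j \<le> Suc k" "x j \<le> y" "r \<le> y" "y \<le> b"
  shows "norm (g j y)
    \<le> M j * exp (real j - real (Suc k)) * exp (exp 1 * (M (Suc k) / M k) * (y - r))"
  using assms(2-)
proof (induction arbitrary: y rule: inc_induct)
  case base
  have "norm (g (Suc k) y) \<le> M (Suc k)"
    using base zeros_in[of "Suc k"] by (intro norm_le) auto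
  also have "\<dots> \<le> M (Suc k) * exp (exp 1 * (M (Suc k) / M k) * (y - r))"
    using base M_pos by (simp add: less_imp_le)
  finally show ?case by simp
next
  case (step j)
  define A where "A i = M i * exp (real i - real (Suc k))" for i
  define c where "c = exp 1 * (M (Suc k) / M k)"
  define p where "p = max (x j) r"
  have p: "a \<le> p" "x j \<le> p" "r \<le> p" "p \<le> y"
    using zeros_in[of j] step.prems by (auto simp: p_def)
  have "norm (g j y) \<le> A j * exp (c * (y - r))"
  proof (rule norm_le_exp_of_derivative_le[OF \<open>p \<le> y\<close>])
    show "continuous_on {p..y} (g j)"
      using p step.prems by (intro continuous_on_subset[OF continuous]) auto
    show "norm (g j p) \<le> A j * exp (c * (p - r))"
      using initial[of j] step.hyps zeros[of j] M_pos[of j]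
      by (auto simp: p_def A_def max_def)
  next
    fix t assume t: "p < t" "t < y"
    show "(g j has_vector_derivative g (Suc j) t) (at t)"
      using t p step.prems by (intro deriv_at) auto
    have "x (Suc j) \<le> x j"
      using decseq_zeros by (rule decseq_SucD)
    then have "norm (g (Suc j) t) \<le> A (Suc j) * exp (c * (t - r))"
      unfolding A_def c_def using t p step.prems by (intro step.IH) auto
    also have "A (Suc j) \<le> A j * c"
      unfolding A_def c_def using log_convex step.hyps by (intro log_convex_seq_exp_Suc_le) auto
    finally show "norm (g (Suc j) t) \<le> A j * exp (c * (t - r)) * c"
      by (simp add: mult_right_mono mult_ac)
  qed
  then show ?case
    by (simp add: A_def c_def)
qed

lemma Bang_zeros_bound:
  assumes "n \<le> N" "j \<le> n" "x j \<le> y" "y \<le> b"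
    and "y \<le> x N + (\<Sum>i=n..<N. M i / M (Suc i)) / exp 1"
  shows "norm (g j y) \<le> M j * exp (real j - real n)"
  using assms
proof (induction arbitrary: j y rule: inc_induct)
  case base
  have "x N \<le> x j"
    using decseqD[OF decseq_zeros] base by simp
  then have "y = x j"
    using base by simp
  then show ?case
    using zeros[of j] M_pos[of j] by simp
next
  case (step k)
  define r where "r = x N + (\<Sum>i=Suc k..<N. M i / M (Suc i)) / exp 1"
  have y_le: "y \<le> r + M k / M (Suc k) / exp 1"
    using step.prems step.hyps by (simp add: r_def sum.atLeast_Suc_lessThan add_divide_distrib)
  have bound_upto_r: "norm (g i z) \<le> M i * exp (real i - real (Suc k))"
    if "i \<le> k" "x i \<le> z" "z \<le> r" "z \<le> b" for i z
    using that by (intro step.IH) (auto simp: r_def)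
  have "norm (g j y) \<le> M j * (exp (real j - real (Suc k)) * exp 1)"
  proof (cases "y \<le> r")
    case True
    then have "norm (g j y) \<le> M j * (exp (real j - real (Suc k)) * 1)"
      using bound_upto_r step.prems by simp
    also have "\<dots> \<le> M j * (exp (real j - real (Suc k)) * exp 1)"
      using M_pos[of j] by (intro mult_left_mono) auto
    finally show ?thesis .
  next
    case False
    have "norm (g j y)
        \<le> M j * (exp (real j - real (Suc k)) * exp (exp 1 * (M (Suc k) / M k) * (y - r)))"
      unfolding mult.assoc[symmetric] using False step.prems
      by (intro Bang_exponential_bound bound_upto_r) auto
    also have "\<dots> \<le> M j * (exp (real j - real (Suc k)) * exp 1)"
      using y_le M_pos[of j] M_pos[of k] M_pos[of "Suc k"]
      by (intro mult_left_mono) (auto simp: field_simps)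
    finally show ?thesis .
  qed
  then show ?case
    by (simp add: exp_add[symmetric])
qed

end

end

lemma not_summable_imp_ivl_sum_unbounded:
  fixes f :: "nat \<Rightarrow> real"
  assumes "\<not> summable f" "\<And>i. 0 \<le> f i"
  obtains N where "m \<le> N" "B < sum f {m..<N}"
proof -
  obtain K where "B < (\<Sum>i<K. f (i + m))"
    using assms summableI_nonneg_bounded[of "\<lambda>i. f (i + m)" B]
    by (auto simp: not_le[symmetric])
  also have "(\<Sum>i<K. f (i + m)) = sum f {m..<K + m}"
    using sum.shift_bounds_nat_ivl[of f 0 m K] by (simp add: lessThan_atLeast0)
  finally show ?thesis
    by (intro that[of "K + m"]) auto
qed

locale quasianalytic_tower = bounded_derivative_tower +
  assumes quasianalytic: "quasianalytic_seq M"
begin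

lemma vanishes_right_of_zeros:
  assumes x: "decseq x" "\<And>n. x n \<in> {a..b}" "\<And>n. g n (x n) = 0"
    and "x n \<le> y" "y \<le> b"
  shows "g n y = 0"
proof -
  have bound: "norm (g n y) \<le> M n * (exp (real n) * exp (- real m))" if "n \<le> m" for m
  proof -
    obtain N where N: "m \<le> N" "exp 1 * (b - a) < (\<Sum>i=m..<N. M i / M (Suc i))"
      by (rule not_summable_imp_ivl_sum_unbounded[of "\<lambda>i. M i / M (Suc i)" m "exp 1 * (b - a)"])
        (use quasianalytic M_pos in \<open>auto simp: quasianalytic_seq_def less_imp_le\<close>)
    then have "b - a \<le> (\<Sum>i=m..<N. M i / M (Suc i)) / exp 1"
      by (simp add: field_simps)
    then have "y \<le> x N + (\<Sum>i=m..<N. M i / M (Suc i)) / exp 1"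
      using \<open>y \<le> b\<close> x(2)[of N] by simp
    then show ?thesis
      using Bang_zeros_bound[OF x, of m N n y] N that assms by (simp add: exp_add[symmetric])
  qed
  have "(\<lambda>m. exp (- real m)) \<longlonglongrightarrow> 0"
    by (intro filterlim_compose[OF exp_at_bot] filterlim_uminus_at_top[THEN iffD1]
        filterlim_real_sequentially)
  then have "(\<lambda>m. M n * (exp (real n) * exp (- real m))) \<longlonglongrightarrow> M n * (exp (real n) * 0)"
    by (intro tendsto_intros)
  then have "norm (g n y) \<le> M n * (exp (real n) * 0)"
    using bound by (intro LIMSEQ_le_const) auto
  then show ?thesis by simp
qed

lemma reflect: "quasianalytic_tower (\<lambda>n t. (-1) ^ n *\<^sub>R g n (- t)) (- b) (- a) M"
proof -
  interpret reflected: derivative_tower "\<lambda>n t. (-1) ^ n *\<^sub>R g n (- t)" "- b" "- a"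
    by (rule derivative_tower.reflect[OF derivative_tower_axioms])
  show ?thesis
    using norm_le log_convex quasianalytic by unfold_locales auto
qed

lemma shift: "quasianalytic_tower (\<lambda>n. g (n + m)) a b (\<lambda>n. M (n + m))"
proof -
  interpret shifted: derivative_tower "\<lambda>n. g (n + m)" a b
    by (rule derivative_tower.shift[OF derivative_tower_axioms])
  show ?thesis
    using norm_le log_convex_seq_shift[OF log_convex] quasianalytic_seq_shift[OF quasianalytic]
    by unfold_locales auto
qed

theorem Denjoy_Carleman:
  assumes flat: "\<And>n. g n c = 0" and "c \<in> {a..b}" "t \<in> {a..b}"
  shows "g n t = 0"
proof (cases "c \<le> t")
  case True
  then show ?thesis
    using vanishes_right_of_zeros[of "\<lambda>_. c" n t] assms by simp
next
  case False
  interpret reflected: quasianalytic_tower "\<lambda>n t. (-1) ^ n *\<^sub>R g n (- t)" "- b" "- a" M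
    by (rule reflect)
  show ?thesis
    using reflected.vanishes_right_of_zeros[of "\<lambda>_. - c" n "- t"] assms False by simp
qed

theorem Bang:
  assumes x: "decseq x" "\<And>n. x n \<in> {a..b}" "\<And>n. g n (x n) = 0" and "t \<in> {a..b}"
  shows "g n t = 0"
proof (rule Denjoy_Carleman)
  show "g n b = 0" for n
    using vanishes_right_of_zeros[OF x] x(2)[of n] by simp
qed (use assms in auto)

end

theorem quasianalytic_tower_positive:
  fixes g :: "nat \<Rightarrow> real \<Rightarrow> real"
  assumes "quasianalytic_tower g a b M" and initial: "\<And>n. 0 < g n a" and t: "t \<in> {a..b}"
  shows "0 < g n t"
proof (rule ccontr)
  assume not_pos: "\<not> 0 < g n t"
  interpret quasianalytic_tower "\<lambda>m. g (m + n)" a b "\<lambda>m. M (m + n)"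
    using assms(1) by (rule quasianalytic_tower.shift)
  obtain x where "decseq x" "\<And>m. x m \<in> {a..b}" "\<And>m. g (m + n) (x m) = 0"
    using derivative_tower_exists_descending_zeros[OF derivative_tower_axioms _ t] initial not_pos
    by (auto simp: not_less)
  then have "g n a = 0"
    using Bang[of x a 0] t by simp
  then show False
    using initial[of n] by simp
qed

corollary quasianalytic_tower_Taylor_coeff_le:
  fixes g :: "nat \<Rightarrow> real \<Rightarrow> real"
  assumes "quasianalytic_tower g a b M" and "\<And>n. 0 < g n a" and "a < b"
  shows "g n a / fact n \<le> g 0 b * (1 / (b - a)) ^ n"
proof -
  interpret quasianalytic_tower g a b M by fact
  have "g (0 + n) a / fact n * (b - a) ^ n \<le> g 0 b"
    using quasianalytic_tower_positive[OF assms(1,2)] \<open>a < b\<close>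
    by (intro derivative_tower_nonneg_Taylor_coeff_le[OF derivative_tower_axioms])
      (auto simp: less_imp_le)
  then show ?thesis
    using \<open>a < b\<close> by (simp add: field_simps)
qed

section \<open>Restriction of a quasianalytic germ to a coordinate axis\<close>

definition axis_derivs :: "(real^'n::finite \<Rightarrow> real) \<Rightarrow> real^'n \<Rightarrow> 'n \<Rightarrow> nat \<Rightarrow> real \<Rightarrow> real" where
  "axis_derivs f p i n t = iter_partial (replicate n i) f (p + t *\<^sub>R axis i 1)"

abbreviation axis_index :: "'n \<Rightarrow> nat \<Rightarrow> 'n \<Rightarrow> nat" where
  "axis_index i n \<equiv> (\<lambda>_. 0)(i := n)"

lemma mlen_axis_index [simp]: "mlen (axis_index i n) = n"
  by (simp add: mlen_def fun_upd_def)

lemma pderiv_multi_axis_index: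
  "pderiv_multi (axis_index i n) f = iter_partial (replicate n i) f"
proof -
  have count_replicate: "count_list (replicate m i) j = axis_index i m j" for m j
    by (induction m) auto
  have "(SOME is. \<forall>j. count_list is j = axis_index i n j) = replicate n i"
  proof (rule some_equality)
    fix "is" assume count: "\<forall>j. count_list is j = axis_index i n j"
    then have "\<forall>j\<in>set is. j = i"
      by (metis count_list_0_iff fun_upd_apply)
    then have "is = replicate (length is) i"
      by (metis replicate_eqI)
    then show "is = replicate n i"
      using count count_replicate by (metis fun_upd_same)
  qed (simp add: count_replicate)
  then show ?thesis
    by (simp add: pderiv_multi_def)
qed

lemma axis_derivs_eq_pderiv_multi:
  "axis_derivs f p i n t = pderiv_multi (axis_index i n) f (p + t *\<^sub>R axis i 1)"
  by (simp add: axis_derivs_def pderiv_multi_axis_index)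

lemma smooth_on_imp_derivative_tower_axis_derivs:
  assumes "smooth_on U f" and segment: "\<And>t. t \<in> {a..b} \<Longrightarrow> p + t *\<^sub>R axis i 1 \<in> U"
  shows "derivative_tower (axis_derivs f p i) a b"
proof
  fix t n assume t: "t \<in> {a..b}"
  let ?f = "iter_partial (replicate n i) f"
  have line: "axis_derivs f p i n (s + t) = ?f (p + t *\<^sub>R axis i 1 + s *\<^sub>R axis i 1)" for s
    by (simp add: axis_derivs_def scaleR_add_left add_ac)
  have "(\<lambda>s. axis_derivs f p i n (s + t)) differentiable (at 0)"
    using assms(1) segment[OF t] unfolding line smooth_on_def by blast
  then have "((\<lambda>s. axis_derivs f p i n (s + t)) has_real_derivative axis_derivs f p i (Suc n) t)
      (at 0)"
    unfolding line by (simp add: axis_derivs_def partial_def DERIV_deriv_iff_real_differentiable)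
  then have "(axis_derivs f p i n has_real_derivative axis_derivs f p i (Suc n) t) (at t)"
    using DERIV_shift[of "axis_derivs f p i n" _ 0 t] by simp
  then show "(axis_derivs f p i n has_vector_derivative axis_derivs f p i (Suc n) t)
      (at t within {a..b})"
    unfolding has_real_derivative_iff_has_vector_derivative
    by (rule has_vector_derivative_at_within)
qed

lemma seminorm_finite_bound:
  assumes "seminorm_finite M K h f" "0 < h" "\<And>p. 0 < M p"
  shows "\<exists>C>0. \<forall>\<alpha>. \<forall>x\<in>K. \<bar>pderiv_multi \<alpha> f x\<bar> \<le> C * h ^ mlen \<alpha> * M (mlen \<alpha>)"
proof -
  obtain C where C: "\<And>\<alpha> x. x \<in> K \<Longrightarrow> \<bar>pderiv_multi \<alpha> f x\<bar> / (h ^ mlen \<alpha> * M (mlen \<alpha>)) \<le> C"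
    using assms(1) unfolding seminorm_finite_def by blast
  have "\<bar>pderiv_multi \<alpha> f x\<bar> \<le> max C 1 * h ^ mlen \<alpha> * M (mlen \<alpha>)" if "x \<in> K" for \<alpha> x
  proof -
    have "\<bar>pderiv_multi \<alpha> f x\<bar> / (h ^ mlen \<alpha> * M (mlen \<alpha>)) \<le> max C 1"
      using C[OF that, of \<alpha>] by simp
    then show ?thesis
      using assms(2,3) by (simp add: pos_divide_le_eq mult_ac)
  qed
  then show ?thesis
    by (intro exI[of _ "max C 1"]) auto
qed

lemma E_Roumieu_imp_quasianalytic_tower_axis_derivs:
  assumes "weight_matrix \<M>" "quasianalytic_matrix \<M>" and f: "f \<in> E_Roumieu \<M> U"
    and segment: "\<And>t. t \<in> {a..b} \<Longrightarrow> p + t *\<^sub>R axis i 1 \<in> U"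
  obtains M where "quasianalytic_tower (axis_derivs f p i) a b M"
proof -
  let ?K = "(\<lambda>t. p + t *\<^sub>R axis i 1) ` {a..b}"
  interpret derivative_tower "axis_derivs f p i" a b
    using f segment by (intro smooth_on_imp_derivative_tower_axis_derivs) (auto simp: E_Roumieu_def)
  have "compact ?K"
    by (intro compact_continuous_image continuous_intros) auto
  moreover have "?K \<subseteq> U"
    using segment by auto
  ultimately obtain l h where "0 < l" "0 < h" and finite_seminorm: "seminorm_finite (\<M> l) ?K h f"
    using f unfolding E_Roumieu_def by blast
  have log_convex: "log_convex_seq (\<M> l)" and quasianalytic: "quasianalytic_seq (\<M> l)"
    using assms(1,2) \<open>0 < l\<close>
    by (auto simp: weight_matrix_def quasianalytic_matrix_def weight_seq_imp_log_convex_seq)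
  obtain C where "0 < C"
    and bound: "\<And>\<alpha> x. x \<in> ?K \<Longrightarrow> \<bar>pderiv_multi \<alpha> f x\<bar> \<le> C * h ^ mlen \<alpha> * \<M> l (mlen \<alpha>)"
    using seminorm_finite_bound[OF finite_seminorm \<open>0 < h\<close> log_convex_seq_pos[OF log_convex]]
    by blast
  have "norm (axis_derivs f p i n t) \<le> C * h ^ n * \<M> l n" if "t \<in> {a..b}" for n t
    using bound[OF imageI[OF that], of "axis_index i n"] by (simp add: axis_derivs_eq_pderiv_multi)
  then have "quasianalytic_tower (axis_derivs f p i) a b (\<lambda>n. C * h ^ n * \<M> l n)"
    using log_convex_seq_geometric_mult[OF log_convex \<open>0 < C\<close> \<open>0 < h\<close>]
      quasianalytic_seq_geometric_mult[OF quasianalytic, of C h] \<open>0 < C\<close> \<open>0 < h\<close>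
    by unfold_locales auto
  then show ?thesis by (rule that)
qed

lemma bdd_above_root_of_geometric_bound:
  fixes \<beta> :: "nat \<Rightarrow> real"
  assumes "\<And>k. \<beta> k \<le> C * D ^ k" "0 \<le> D"
  shows "bdd_above (range (\<lambda>k. root k (\<beta> k)))"
proof (rule bdd_aboveI2)
  fix k
  show "root k (\<beta> k) \<le> max C 1 * D"
  proof (cases "k = 0")
    case False
    have "C \<le> max C 1 ^ k"
      using self_le_power[of "max C 1" k] False by simp
    then have "C * D ^ k \<le> (max C 1 * D) ^ k"
      using assms(2) by (simp add: power_mult_distrib mult_right_mono)
    then have "root k (\<beta> k) \<le> root k ((max C 1 * D) ^ k)"
      using assms(1)[of k] False by simp
    then show ?thesis
      using assms(2) False by (simp add: real_root_power_cancel)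
  qed (use assms(2) in simp)
qed

theorem jets_Roumieu_positive_imp_bdd_above_root:
  fixes b :: "('n::finite \<Rightarrow> nat) \<Rightarrow> real"
  assumes "weight_matrix \<M>" "quasianalytic_matrix \<M>" and "b \<in> jets_Roumieu \<M>"
    and positive: "\<And>n. 0 < b (axis_index i n)"
  shows "bdd_above (range (\<lambda>n. root n (b (axis_index i n))))"
proof -
  obtain f k where "1 \<le> k" and f: "f \<in> E_Roumieu \<M> (cube k)" and b: "b = jet f"
    using \<open>b \<in> jets_Roumieu \<M>\<close> unfolding jets_Roumieu_def by blast
  define r where "r = 1 / (2 * real k)"
  have "0 < r"
    using \<open>1 \<le> k\<close> by (simp add: r_def)
  have "0 + t *\<^sub>R axis i 1 \<in> (cube k :: (real^'n) set)" if "t \<in> {0..r}" for t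
    using that \<open>1 \<le> k\<close> by (auto simp: cube_def axis_def r_def field_simps)
  then obtain M where tower: "quasianalytic_tower (axis_derivs f 0 i) 0 r M"
    by (rule E_Roumieu_imp_quasianalytic_tower_axis_derivs[OF assms(1,2) f])
  have jet: "b (axis_index i n) = axis_derivs f 0 i n 0 / fact n" for n
    by (simp add: b jet_def axis_derivs_eq_pderiv_multi)
  have "0 < axis_derivs f 0 i n 0" for n
    using positive[of n] by (simp add: jet zero_less_divide_iff)
  from quasianalytic_tower_Taylor_coeff_le[OF tower this \<open>0 < r\<close>]
  have "b (axis_index i n) \<le> axis_derivs f 0 i 0 r * (1 / r) ^ n" for n
    by (simp add: jet)
  then show ?thesis
    by (rule bdd_above_root_of_geometric_bound) (use \<open>0 < r\<close> in simp)
qed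

section \<open>Radial sequences\<close>

definition radial :: "(nat \<Rightarrow> real) \<Rightarrow> ('n::finite \<Rightarrow> nat) \<Rightarrow> real" where
  "radial \<beta> \<alpha> = \<beta> (mlen \<alpha>)"

lemma unbounded_radial_not_subset_jets_Roumieu:
  assumes "weight_matrix \<M>" "quasianalytic_matrix \<M>"
    and "\<And>k. 0 < \<beta> k" "\<not> bdd_above (range (\<lambda>k. root k (\<beta> k)))"
    and mem: "(radial \<beta> :: ('n::finite \<Rightarrow> nat) \<Rightarrow> real) \<in> \<Lambda>"
  shows "\<not> \<Lambda> \<subseteq> jets_Roumieu \<M>"
proof
  fix i :: 'n
  assume "\<Lambda> \<subseteq> jets_Roumieu \<M>"
  with mem have "(radial \<beta> :: ('n \<Rightarrow> nat) \<Rightarrow> real) \<in> jets_Roumieu \<M>" by blast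
  then have "bdd_above (range (\<lambda>k. root k (radial \<beta> (axis_index i k))))"
    by (rule jets_Roumieu_positive_imp_bdd_above_root[OF assms(1,2)])
      (simp add: radial_def assms(3))
  then show False
    using assms(4) by (simp add: radial_def)
qed

lemma seqnorm_finite_radial:
  assumes "Bseq (\<lambda>k. \<beta> k / (h ^ k * (N k / fact k)))" "\<And>k. 0 < N k" "0 < h"
  shows "seqnorm_finite N h (radial \<beta>)"
proof -
  obtain C where "\<forall>k. norm (\<beta> k / (h ^ k * (N k / fact k))) \<le> C"
    using assms(1) by (rule BseqE)
  then show ?thesis
    using assms(2,3) by (auto simp: seqnorm_finite_def radial_def abs_mult less_imp_le)
qed

theorem Lambda_Roumieu_not_subset_jets_Roumieu:
  assumes "weight_matrix \<M>" "quasianalytic_matrix \<M>" and "weight_matrix \<N>" and "0 < l"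
    and sup_root: "(SUP k\<in>{0<..}. ereal (root k (\<N> l k / fact k))) = \<infinity>"
  shows "\<not> Lambda_Roumieu \<N> \<subseteq> (jets_Roumieu \<M> :: (('n::finite \<Rightarrow> nat) \<Rightarrow> real) set)"
proof (rule unbounded_radial_not_subset_jets_Roumieu[OF assms(1,2)])
  have N_pos: "0 < \<N> l k" for k
    using assms by (simp add: weight_matrix_def weight_seq_def)
  then show "0 < \<N> l k / fact k" for k
    by simp
  show "\<not> bdd_above (range (\<lambda>k. root k (\<N> l k / fact k)))"
  proof
    assume "bdd_above (range (\<lambda>k. root k (\<N> l k / fact k)))"
    then obtain B where "\<And>k. root k (\<N> l k / fact k) \<le> B"
      by (auto simp: bdd_above_def)
    then have "(SUP k\<in>{0<..}. ereal (root k (\<N> l k / fact k))) \<le> ereal B"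
      by (intro SUP_least) simp
    then show False
      using sup_root by simp
  qed
  have "Bseq (\<lambda>k. \<N> l k / fact k / (1 ^ k * (\<N> l k / fact k)))"
    using N_pos by (simp add: less_imp_neq[symmetric])
  then have "seqnorm_finite (\<N> l) 1 (radial (\<lambda>k. \<N> l k / fact k))"
    using N_pos by (intro seqnorm_finite_radial) auto
  then show "radial (\<lambda>k. \<N> l k / fact k) \<in> Lambda_Roumieu \<N>"
    unfolding Lambda_Roumieu_def using \<open>0 < l\<close> zero_less_one by blast
qed

lemma filterlim_at_top_diagonal:
  fixes F :: "nat \<Rightarrow> nat \<Rightarrow> real"
  assumes lim: "\<And>j. filterlim (F j) at_top sequentially"
  obtains \<sigma> :: "nat \<Rightarrow> real" where "\<And>k. 0 < \<sigma> k" "filterlim \<sigma> at_top sequentially"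
    "\<And>j. \<forall>\<^sub>F k in sequentially. \<sigma> k \<le> F j k"
proof
  define S where "S k = {j. j \<le> k \<and> (\<forall>i\<le>j. real (Suc j) \<le> F i k)}" for k
  define J where "J k = Max (insert 0 (S k))" for k
  have finite_S: "finite (S k)" for k
    by (simp add: S_def)
  have in_S: "\<forall>\<^sub>F k in sequentially. j \<in> S k" for j
  proof -
    have "\<forall>\<^sub>F k in sequentially. \<forall>i\<in>{..j}. real (Suc j) \<le> F i k"
      using lim by (intro eventually_ball_finite) (auto simp: filterlim_at_top)
    then show ?thesis
      using eventually_ge_at_top[of j] by eventually_elim (auto simp: S_def)
  qed
  have J_ge: "\<forall>\<^sub>F k in sequentially. j \<le> J k" for j
    using in_S[of j] by eventually_elim (simp add: J_def finite_S)
  show "0 < real (Suc (J k))" for k by simp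
  show "filterlim (\<lambda>k. real (Suc (J k))) at_top sequentially"
    unfolding filterlim_at_top
  proof
    fix Z :: real
    obtain j where "Z \<le> real j"
      using real_arch_simple by blast
    then show "\<forall>\<^sub>F k in sequentially. Z \<le> real (Suc (J k))"
      using J_ge[of j] by (auto elim: eventually_mono)
  qed
  show "\<forall>\<^sub>F k in sequentially. real (Suc (J k)) \<le> F j k" for j
    using J_ge[of j] in_S[of 0]
  proof eventually_elim
    case (elim k)
    then have "J k \<in> S k"
      using Max_in[of "insert 0 (S k)"] by (auto simp: J_def finite_S)
    then show ?case
      using elim by (simp add: S_def)
  qed
qed

lemma exists_filterlim_at_top_below_roots:
  assumes "weight_matrix \<N>"
    and lim: "\<And>l. 0 < l \<Longrightarrow> filterlim (\<lambda>k. root k (\<N> l k / fact k)) at_top sequentially"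
  obtains \<sigma> :: "nat \<Rightarrow> real" where "\<And>k. 0 < \<sigma> k" "filterlim \<sigma> at_top sequentially"
    "\<And>l h. 0 < l \<Longrightarrow> 0 < h \<Longrightarrow> \<forall>\<^sub>F k in sequentially. \<sigma> k \<le> h * root k (\<N> l k / fact k)"
proof -
  define \<epsilon> where "\<epsilon> j = inverse (real (Suc j))" for j
  define \<rho> where "\<rho> l k = root k (\<N> l k / fact k)" for l k
  have \<epsilon>_pos: "0 < \<epsilon> j" for j
    by (simp add: \<epsilon>_def)
  have \<rho>_mono: "\<rho> l k \<le> \<rho> l' k" if "0 < l" "l \<le> l'" "0 < k" for l l' k
    using assms(1) that by (simp add: \<rho>_def weight_matrix_def divide_right_mono)
  have \<rho>_nonneg: "0 \<le> \<rho> l k" if "0 < l" for l k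
    using assms(1) that
    by (simp add: \<rho>_def weight_matrix_def weight_seq_def real_root_ge_zero less_imp_le)
  have "filterlim (\<lambda>k. \<epsilon> j * \<rho> (\<epsilon> j) k) at_top sequentially" for j
    using lim \<epsilon>_pos unfolding \<rho>_def
    by (intro filterlim_tendsto_pos_mult_at_top[OF tendsto_const]) auto
  then obtain \<sigma> where "\<And>k. 0 < \<sigma> k" "filterlim \<sigma> at_top sequentially"
    and \<sigma>_le: "\<And>j. \<forall>\<^sub>F k in sequentially. \<sigma> k \<le> \<epsilon> j * \<rho> (\<epsilon> j) k"
    using filterlim_at_top_diagonal[of "\<lambda>j k. \<epsilon> j * \<rho> (\<epsilon> j) k"] by blast
  moreover have "\<forall>\<^sub>F k in sequentially. \<sigma> k \<le> h * \<rho> l k" if "0 < l" "0 < h" for l h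
  proof -
    have "\<exists>j. \<epsilon> j < min l h"
      unfolding \<epsilon>_def using that by (intro reals_Archimedean) simp
    then obtain j where j: "\<epsilon> j < l" "\<epsilon> j < h"
      by auto
    show ?thesis
      using \<sigma>_le[of j] eventually_gt_at_top[of 0]
    proof eventually_elim
      case (elim k)
      have "\<epsilon> j * \<rho> (\<epsilon> j) k \<le> h * \<rho> l k"
        using j \<epsilon>_pos[of j] \<rho>_nonneg[of "\<epsilon> j"] \<rho>_mono elim by (intro mult_mono) auto
      then show ?case
        using elim by linarith
    qed
  qed
  ultimately show ?thesis
    using that unfolding \<rho>_def by blast
qed

lemma not_bdd_above_root_power:
  fixes \<sigma> :: "nat \<Rightarrow> real"
  assumes "filterlim \<sigma> at_top sequentially"
  shows "\<not> bdd_above (range (\<lambda>k. root k (\<sigma> k ^ k)))"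
proof
  assume "bdd_above (range (\<lambda>k. root k (\<sigma> k ^ k)))"
  then obtain B where B: "root k (\<sigma> k ^ k) \<le> B" for k
    by (auto simp: bdd_above_def)
  have "\<forall>\<^sub>F k in sequentially. max 0 B < \<sigma> k"
    using assms unfolding filterlim_at_top_dense by blast
  then have "\<forall>\<^sub>F k :: nat in sequentially. False"
    using eventually_gt_at_top[of 0]
  proof eventually_elim
    case (elim k)
    then have "root k (\<sigma> k ^ k) = \<sigma> k"
      by (simp add: real_root_power_cancel)
    then show False
      using B[of k] elim by simp
  qed
  then show False by simp
qed

lemma Bseq_power_divide_of_le_root:
  fixes \<sigma> n :: "nat \<Rightarrow> real"
  assumes le: "\<forall>\<^sub>F k in sequentially. \<sigma> k \<le> h * root k (n k)"
    and "\<And>k. 0 \<le> \<sigma> k" "\<And>k. 0 < n k" "0 < h"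
  shows "Bseq (\<lambda>k. \<sigma> k ^ k / (h ^ k * n k))"
proof (rule Bseq_eventually_mono)
  show "\<forall>\<^sub>F k in sequentially. norm (\<sigma> k ^ k / (h ^ k * n k)) \<le> norm (1 :: real)"
    using le eventually_gt_at_top[of 0]
  proof eventually_elim
    case (elim k)
    have "\<sigma> k ^ k \<le> (h * root k (n k)) ^ k"
      using elim assms(2) by (intro power_mono) auto
    also have "\<dots> = h ^ k * n k"
      using elim assms(3)[of k] by (simp add: power_mult_distrib)
    finally show ?case
      using assms(2,3)[of k] \<open>0 < h\<close> by (simp add: abs_mult)
  qed
qed simp

theorem Lambda_Beurling_not_subset_jets_Roumieu:
  assumes "weight_matrix \<M>" "quasianalytic_matrix \<M>" and "weight_matrix \<N>"
    and lim: "\<And>l. 0 < l \<Longrightarrow> filterlim (\<lambda>k. root k (\<N> l k / fact k)) at_top sequentially"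
  shows "\<not> Lambda_Beurling \<N> \<subseteq> (jets_Roumieu \<M> :: (('n::finite \<Rightarrow> nat) \<Rightarrow> real) set)"
proof -
  obtain \<sigma> :: "nat \<Rightarrow> real" where \<sigma>_pos: "\<And>k. 0 < \<sigma> k" and \<sigma>_lim: "filterlim \<sigma> at_top sequentially"
    and \<sigma>_le: "\<And>l h. 0 < l \<Longrightarrow> 0 < h \<Longrightarrow>
      \<forall>\<^sub>F k in sequentially. \<sigma> k \<le> h * root k (\<N> l k / fact k)"
    using exists_filterlim_at_top_below_roots[OF assms(3) lim] by blast
  have "seqnorm_finite (\<N> l) h (radial (\<lambda>k. \<sigma> k ^ k) :: ('n \<Rightarrow> nat) \<Rightarrow> real)"
    if "0 < l" "0 < h" for l h
    using that assms(3) \<sigma>_pos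
    by (intro seqnorm_finite_radial Bseq_power_divide_of_le_root \<sigma>_le)
      (auto simp: weight_matrix_def weight_seq_def less_imp_le)
  then have "(radial (\<lambda>k. \<sigma> k ^ k) :: ('n \<Rightarrow> nat) \<Rightarrow> real) \<in> Lambda_Beurling \<N>"
    by (simp add: Lambda_Beurling_def)
  then show ?thesis
    using \<sigma>_pos not_bdd_above_root_power[OF \<sigma>_lim]
    by (intro unbounded_radial_not_subset_jets_Roumieu[OF assms(1,2)]) auto
qed

lemma jets_Beurling_subset_Roumieu: "jets_Beurling \<M> \<subseteq> jets_Roumieu \<M>"
proof -
  have "E_Beurling \<M> U \<subseteq> E_Roumieu \<M> U" for U
    unfolding E_Beurling_def E_Roumieu_def using zero_less_one by blast
  then show ?thesis
    unfolding jets_Beurling_def jets_Roumieu_def by blast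
qed

theorem mainTheorem10:
  fixes \<M> \<N> :: "real \<Rightarrow> nat \<Rightarrow> real"
  assumes "weight_matrix \<M>" and "quasianalytic_matrix \<M>"
    and "weight_matrix \<N>" and "quasianalytic_matrix \<N>"
  shows
    "((\<forall>l>0. (SUP k\<in>{0<..}. ereal (root k (\<N> l k / fact k))) = \<infinity>) \<longrightarrow>
        jets_Roumieu \<M> \<inter> Lambda_Roumieu \<N> \<subset> (Lambda_Roumieu \<N> :: (('n::finite \<Rightarrow> nat) \<Rightarrow> real) set) \<and>
        jets_Beurling \<M> \<inter> Lambda_Roumieu \<N> \<subset> (Lambda_Roumieu \<N> :: (('n \<Rightarrow> nat) \<Rightarrow> real) set) \<and>
        \<not> (Lambda_Roumieu \<N> :: (('n \<Rightarrow> nat) \<Rightarrow> real) set) \<subseteq> jets_Roumieu \<N>)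
   \<and> ((\<forall>l>0. filterlim (\<lambda>k. root k (\<N> l k / fact k)) at_top sequentially) \<longrightarrow>
        jets_Roumieu \<M> \<inter> Lambda_Beurling \<N> \<subset> (Lambda_Beurling \<N> :: (('n \<Rightarrow> nat) \<Rightarrow> real) set) \<and>
        jets_Beurling \<M> \<inter> Lambda_Beurling \<N> \<subset> (Lambda_Beurling \<N> :: (('n \<Rightarrow> nat) \<Rightarrow> real) set) \<and>
        \<not> (Lambda_Beurling \<N> :: (('n \<Rightarrow> nat) \<Rightarrow> real) set) \<subseteq> jets_Beurling \<N>)"
  (is "(?sup \<longrightarrow> ?Roumieu) \<and> (?lim \<longrightarrow> ?Beurling)")
proof (rule conjI; rule impI)
  assume ?sup
  then have "\<not> Lambda_Roumieu \<N> \<subseteq> (jets_Roumieu \<M> :: (('n \<Rightarrow> nat) \<Rightarrow> real) set)"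
    and "\<not> Lambda_Roumieu \<N> \<subseteq> (jets_Roumieu \<N> :: (('n \<Rightarrow> nat) \<Rightarrow> real) set)"
    using Lambda_Roumieu_not_subset_jets_Roumieu[OF assms(1-3) zero_less_one]
      Lambda_Roumieu_not_subset_jets_Roumieu[OF assms(3,4,3) zero_less_one] by simp_all
  then show ?Roumieu
    using jets_Beurling_subset_Roumieu[of \<M>] by blast
next
  assume ?lim
  then have "\<not> Lambda_Beurling \<N> \<subseteq> (jets_Roumieu \<M> :: (('n \<Rightarrow> nat) \<Rightarrow> real) set)"
    and "\<not> Lambda_Beurling \<N> \<subseteq> (jets_Roumieu \<N> :: (('n \<Rightarrow> nat) \<Rightarrow> real) set)"
    using Lambda_Beurling_not_subset_jets_Roumieu[OF assms(1-3)]
      Lambda_Beurling_not_subset_jets_Roumieu[OF assms(3,4,3)] by simp_all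
  then show ?Beurling
    using jets_Beurling_subset_Roumieu by blast
qed

end
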